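(* Let $k\ge 3$ be an integer, let $\Lambda_k$ be the constant $$\Lambda_k=\min_{a\in[0,1)}\ \sup_{x\in(0,1]} x\left|1-\frac{1}{1-\tau_k^{[a,1]}(x)^2}\right|,$$ and let $a_k^*\in(0,1)$ be such that $$\sup_{x\in(0,1]} x\left|1-\frac{1}{1-\tau_k^{[a_k^*,1]}(x)^2}\right|=\Lambda_k.$$ Then $$\frac{\log(k)^2}{9k^2}\le a_k^*\le \frac{\log(k)^2}{k^2}\qquad\text{and}\qquad \frac{\log(k)}{6k^2}\le \Lambda_k\le 1.03\cdot\frac{\log(k)}{2k^2}.$$
   Context: $\log$ is the natural logarithm. $\tau_k$ denotes the Chebyshev polynomial of the first kind of degree $k$: $\tau_0(x)=1$, $\tau_1(x)=x$, $\tau_{k+1}(x)=2x\,\tau_k(x)-\tau_{k-1}(x)$. For $a\in[0,1)$, the scaled and shifted Chebyshev polynomial on $[a,1]$ is $$\tau_k^{[a,1]}(x)=\tau_k\left(\frac{1+a-2x}{1-a}\right)\Big/\tau_k\left(\frac{1+a}{1-a}\right),$$ so that $\tau_k^{[a,1]}(0)=1$. The objective $x\left|1-\frac{1}{1-\tau_k^{[a,1]}(x)^2}\right|=\frac{x\,\tau_k^{[a,1]}(x)^2}{|1-\tau_k^{[a,1]}(x)^2|}$ is taken to be $+\infty$ at points $x\in(0,1]$ where $\tau_k^{[a,1]}(x)^2=1$ (this occurs only for $a=0$). *)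

theory Defs
  imports "HOL-Analysis.Analysis"
begin

text \<open>Chebyshev polynomials of the first kind, as functions on the reals.\<close>

fun cheb :: "nat \<Rightarrow> real \<Rightarrow> real" where
  "cheb 0 x = 1"
| "cheb (Suc 0) x = x"
| "cheb (Suc (Suc k)) x = 2 * x * cheb (Suc k) x - cheb k x"

definition cheb_scaled :: "nat \<Rightarrow> real \<Rightarrow> real \<Rightarrow> real" where
  "cheb_scaled k a x = cheb k ((1 + a - 2 * x) / (1 - a)) / cheb k ((1 + a) / (1 - a))"

text \<open>
  The objective is extended-real valued. The case distinction is needed because
  \<^term>\<open>1 / 0 = (0 :: real)\<close>: where the denominator vanishes, the value is \<^term>\<open>\<infinity> :: ereal\<close>.
\<close>

definition objective :: "nat \<Rightarrow> real \<Rightarrow> real \<Rightarrow> ereal" where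
  "objective k a x =
     (if (cheb_scaled k a x)\<^sup>2 = 1 then \<infinity>
      else ereal (x * \<bar>1 - 1 / (1 - (cheb_scaled k a x)\<^sup>2)\<bar>))"

definition sup_objective :: "nat \<Rightarrow> real \<Rightarrow> ereal" where
  "sup_objective k a = (SUP x\<in>{0<..1}. objective k a x)"

text \<open>
  The minimum over \<open>a\<close> is written as an infimum; the definition does not presuppose that it
  is attained.
\<close>

definition Lambda :: "nat \<Rightarrow> ereal" where
  "Lambda k = (INF a\<in>{0..<1}. sup_objective k a)"

end

theory Submission
  imports Defs
begin

text \<open>
  Write \<open>a = tanh\<^sup>2 \<psi>\<close> with \<open>\<psi> > 0\<close>. Then \<open>(1 + a) / (1 - a) = cosh (2\<psi>)\<close>, so the normalising
  constant of the scaled polynomial \<open>p\<close> is \<open>D = cosh (2k\<psi>)\<close>. On \<open>[a, 1]\<close> the polynomial oscillates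
  between \<open>-1/D\<close> and \<open>1/D\<close>, and \<open>x p\<^sup>2 / (1 - p\<^sup>2)\<close> is largest at \<open>x = 1\<close>, where it equals
  \<open>1 / (D\<^sup>2 - 1) = 1 / sinh\<^sup>2 (2k\<psi>)\<close>. On \<open>(0, a)\<close> the objective is \<open>x / (1/p\<^sup>2 - 1)\<close>. Here \<open>p\<close> is
  positive and log-concave, so \<open>1/p\<^sup>2\<close> lies above its tangent at \<open>0\<close>; hence the objective is at most
  \<open>1 / (2 \<bar>p'(0)\<bar>) = tanh \<psi> / (2k tanh (2k\<psi>))\<close>, which is also its limit as \<open>x\<close> tends to \<open>0\<close>.
  The supremum is therefore the maximum of these two values (\<open>sup_objective_tanh\<close>).

  The first value strictly decreases in \<open>\<psi>\<close>, and the second strictly increases because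
  \<open>tanh (n\<psi>) / tanh \<psi>\<close> decreases. The same monotonicity gives the log-concavity used above. So the
  minimum is attained exactly where the two values agree, that is, at the root of
  \<open>tanh \<psi> sinh (4k\<psi>) = 4k\<close> (\<open>minimizer_characterization\<close>; the value at \<open>a = 0\<close> is infinite).

  It remains to locate this root. With \<open>u = ln k / k\<close>, the number \<open>sinh (4k\<psi>)\<close> is about \<open>k^4 / 2\<close> at
  \<open>\<psi> = u\<close> and about \<open>k^(3/2) / 2\<close> at \<open>\<psi> = 3u/8\<close>, while \<open>tanh \<psi>\<close> is comparable to \<open>u\<close>. The left side
  is thus too large at the first point and too small at the second, and the root lies
  between them (\<open>balance_point_exists\<close>). The bounds on \<open>a = tanh\<^sup>2 \<psi>\<close> follow since \<open>tanh \<psi>\<close> differs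
  little from \<open>\<psi>\<close>. The bounds on the minimum follow from the second value, whose denominator
  contains, besides \<open>2k\<close>, only the factor \<open>tanh (2k\<psi>)\<close>: it is at most \<open>1\<close>, and at \<open>\<psi> = u\<close> it equals
  \<open>tanh (2 ln k)\<close>, which is already close to \<open>1\<close> for \<open>k = 3\<close>.
\<close>

section \<open>Chebyshev polynomials in trigonometric and hyperbolic coordinates\<close>

lemma cheb_cos: "cheb k (cos t) = cos (real k * t)"
proof (induction k "cos t" rule: cheb.induct)
  case (3 k)
  have "cos (real (Suc (Suc k)) * t) = 2 * cos t * cos (real (Suc k) * t) - cos (real k * t)"
    using cos_add[of "real (Suc k) * t" t] cos_diff[of "real (Suc k) * t" t]
    by (simp add: algebra_simps)
  with 3 show ?case by simp
qed simp_all

lemma cheb_cosh: "cheb k (cosh t) = cosh (real k * t)"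
proof (induction k "cosh t" rule: cheb.induct)
  case (3 k)
  have "cosh (real (Suc (Suc k)) * t) = 2 * cosh t * cosh (real (Suc k) * t) - cosh (real k * t)"
    using cosh_add[of "real (Suc k) * t" t] cosh_diff[of "real (Suc k) * t" t]
    by (simp add: algebra_simps)
  with 3 show ?case by simp
qed simp_all

section \<open>Monotonicity of hyperbolic tangent ratios\<close>

lemma tanh_ratio_Suc:
  fixes x :: real
  assumes "x > 0"
  shows "tanh (real (Suc n) * x) / tanh x
       = (tanh (real n * x) / tanh x + 1) / (1 + tanh (real n * x) * tanh x)"
proof -
  have "tanh (real (Suc n) * x) = (tanh (real n * x) + tanh x) / (1 + tanh (real n * x) * tanh x)"
    using tanh_add[of "real n * x" x] cosh_real_pos[of "real n * x"] cosh_real_pos[of x]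
    by (simp add: algebra_simps)
  moreover have "tanh x > 0" using assms by simp
  ultimately show ?thesis by (simp add: add_divide_distrib)
qed

text \<open>
  Induction along the recursion \<open>tanh_ratio_Suc\<close>: as the argument grows, the numerator
  decreases by the induction hypothesis, and the denominator increases.
\<close>

lemma tanh_ratio_antimono:
  fixes x y :: real
  assumes "0 < x" "x \<le> y"
  shows "tanh (real n * y) / tanh y \<le> tanh (real n * x) / tanh x"
proof (induction n)
  case (Suc n)
  have "tanh (real n * x) * tanh x \<le> tanh (real n * y) * tanh y"
    using assms by (intro mult_mono) (auto intro!: mult_left_mono)
  then show ?case
    unfolding tanh_ratio_Suc[OF assms(1)] tanh_ratio_Suc[OF less_le_trans[OF assms]]
    using assms Suc by (intro frac_le) (auto intro!: add_nonneg_nonneg add_pos_nonneg)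
qed simp

text \<open>
  Strictness comes from the denominator \<open>1 + tanh (m x) tanh x\<close> of the last recursion step, with
  \<open>n = m + 1\<close>. It needs \<open>m > 0\<close>; for \<open>n = 1\<close> the ratio is constant.
\<close>

lemma tanh_ratio_strict_antimono:
  fixes x y :: real
  assumes "0 < x" "x < y" "n \<ge> 2"
  shows "tanh (real n * y) / tanh y < tanh (real n * x) / tanh x"
proof -
  obtain m where n: "n = Suc m" and m: "m > 0"
    using assms(3) by (cases n) auto
  have "tanh (real m * x) * tanh x < tanh (real m * y) * tanh y"
    using assms m by (intro mult_strict_mono) auto
  moreover have "0 < tanh (real m * x) / tanh x"
    using assms m by simp
  ultimately show ?thesis
    unfolding n tanh_ratio_Suc[OF assms(1)] tanh_ratio_Suc[OF less_trans[OF assms(1,2)]]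
    using assms tanh_ratio_antimono[of x y m] m
    by (intro frac_less2) (auto intro!: add_nonneg_nonneg add_pos_nonneg)
qed

text \<open>
  Up to the factor \<open>k\<close>, \<open>tanh (k x) / sinh x\<close> is the logarithmic derivative of the \<open>k\<close>-th Chebyshev
  polynomial at \<open>cosh x\<close>. So this monotonicity is the log-concavity of that polynomial on \<open>[1, \<infinity>)\<close>.
\<close>

lemma tanh_over_sinh_antimono:
  fixes x y :: real
  assumes "0 < x" "x \<le> y"
  shows "tanh (real k * y) / sinh y \<le> tanh (real k * x) / sinh x"
proof -
  have eq: "tanh (real k * z) / sinh z = tanh (real k * z) / tanh z * (1 / cosh z)" for z :: real
    using cosh_real_pos[of z] by (simp add: tanh_def)
  show ?thesis unfolding eq using assms
    by (intro mult_mono tanh_ratio_antimono divide_left_mono) (auto simp: cosh_real_nonneg_le_iff)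
qed

text \<open>
  Concavity of \<open>ln \<tau>\<close>, with \<open>\<tau>\<close> the \<open>k\<close>-th Chebyshev polynomial, puts \<open>ln \<tau>\<close> below its tangent at
  \<open>cosh \<theta>\<close>; exponentiating and using \<open>exp t \<ge> 1 + t\<close> turns this into a linear lower bound for
  \<open>(\<tau> (cosh \<theta>) / \<tau> (cosh \<phi>))\<^sup>2\<close>.
\<close>

lemma cosh_ratio_ge_tangent:
  fixes \<phi> \<theta> :: real
  assumes "0 < \<phi>" "\<phi> \<le> \<theta>"
  shows "1 + 2 * (real k * tanh (real k * \<theta>) / sinh \<theta>) * (cosh \<theta> - cosh \<phi>)
       \<le> (cosh (real k * \<theta>) / cosh (real k * \<phi>))\<^sup>2"
proof -
  define M where "M = real k * tanh (real k * \<theta>) / sinh \<theta>"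
  define H where "H = (\<lambda>z. ln (cosh (real k * z)) - M * cosh z)"
  \<comment> \<open>\<open>M\<close> is the slope of the tangent, and \<open>H\<close> is \<open>ln \<tau>\<close> minus the linear part of that tangent. \<open>H\<close>
    increases up to \<open>\<theta>\<close> because the logarithmic derivative of \<open>\<tau>\<close> is at least \<open>M\<close> there.\<close>
  have "H \<phi> \<le> H \<theta>"
  proof (rule DERIV_nonneg_imp_nondecreasing[OF assms(2)])
    fix z assume z: "\<phi> \<le> z" "z \<le> \<theta>"
    have "(H has_real_derivative (real k * tanh (real k * z) - M * sinh z)) (at z)"
      unfolding H_def using cosh_real_pos[of "real k * z"]
      by (auto intro!: derivative_eq_intros simp: tanh_def field_simps)
    moreover have "real k * (tanh (real k * \<theta>) / sinh \<theta>) \<le> real k * (tanh (real k * z) / sinh z)"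
      using z assms by (intro mult_left_mono tanh_over_sinh_antimono) auto
    then have "0 \<le> real k * tanh (real k * z) - M * sinh z"
      using z assms by (simp add: M_def pos_le_divide_eq)
    ultimately show "\<exists>d. DERIV H z :> d \<and> 0 \<le> d" by blast
  qed
  then have "2 * (M * (cosh \<theta> - cosh \<phi>)) \<le> 2 * ln (cosh (real k * \<theta>) / cosh (real k * \<phi>))"
    using cosh_real_pos[of "real k * \<theta>"] cosh_real_pos[of "real k * \<phi>"]
    by (simp add: H_def ln_div algebra_simps)
  also have "\<dots> = ln ((cosh (real k * \<theta>) / cosh (real k * \<phi>))\<^sup>2)"
    using cosh_real_pos[of "real k * \<theta>"] cosh_real_pos[of "real k * \<phi>"]
    by (simp add: ln_realpow)
  finally have "exp (2 * (M * (cosh \<theta> - cosh \<phi>))) \<le> (cosh (real k * \<theta>) / cosh (real k * \<phi>))\<^sup>2"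
    using cosh_real_pos[of "real k * \<theta>"] cosh_real_pos[of "real k * \<phi>"]
    by (subst (asm) ln_ge_iff) (auto intro!: divide_pos_pos zero_less_power)
  then have "1 + 2 * (M * (cosh \<theta> - cosh \<phi>)) \<le> (cosh (real k * \<theta>) / cosh (real k * \<phi>))\<^sup>2"
    using exp_ge_add_one_self[of "2 * (M * (cosh \<theta> - cosh \<phi>))"] by linarith
  then show ?thesis by (simp add: M_def mult.assoc)
qed

section \<open>The substitution a = tanh squared\<close>

lemma one_minus_tanh_sq: "1 - (tanh \<psi>)\<^sup>2 = 1 / (cosh (\<psi>::real))\<^sup>2"
  using hyperbolic_pythagoras[of \<psi>]
  by (simp add: tanh_def power_divide eq_divide_eq left_diff_distrib)

lemma chebyshev_arg_tanh:
  fixes \<psi> x :: real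
  shows "(1 + (tanh \<psi>)\<^sup>2 - 2 * x) / (1 - (tanh \<psi>)\<^sup>2) = cosh (2 * \<psi>) - 2 * x * (cosh \<psi>)\<^sup>2"
proof -
  have c: "cosh \<psi> > 0" by simp
  have "(cosh \<psi>)\<^sup>2 * (1 + (tanh \<psi>)\<^sup>2) = cosh (2 * \<psi>)"
    unfolding cosh_double using c by (simp add: tanh_def power_divide distrib_left)
  then show ?thesis unfolding one_minus_tanh_sq by (simp add: algebra_simps)
qed

lemma cheb_scaled_tanh:
  "cheb_scaled k ((tanh \<psi>)\<^sup>2) x
   = cheb k (cosh (2 * \<psi>) - 2 * x * (cosh \<psi>)\<^sup>2) / cosh (real k * (2 * \<psi>))"
  using chebyshev_arg_tanh[of \<psi> x] chebyshev_arg_tanh[of \<psi> 0]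
  by (simp add: cheb_scaled_def cheb_cosh)

lemma objective_eq:
  assumes "(cheb_scaled k a x)\<^sup>2 < 1"
  shows "objective k a x = ereal (x * ((cheb_scaled k a x)\<^sup>2 / (1 - (cheb_scaled k a x)\<^sup>2)))"
proof -
  define q where "q = (cheb_scaled k a x)\<^sup>2"
  have q: "0 \<le> q" "q < 1" using assms by (auto simp: q_def)
  then have "1 - 1 / (1 - q) = - (q / (1 - q))" by (simp add: field_simps)
  then have "\<bar>1 - 1 / (1 - q)\<bar> = q / (1 - q)" using q by simp
  then show ?thesis using assms by (simp add: objective_def q_def)
qed

text \<open>
  The value of the objective at \<open>x = 1\<close>: there the scaled polynomial has square \<open>1/D\<^sup>2\<close> with
  \<open>D = cosh (2k\<psi>)\<close>, and \<open>D\<^sup>2 - 1 = sinh\<^sup>2 (2k\<psi>)\<close>.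
\<close>

definition endpoint_value :: "nat \<Rightarrow> real \<Rightarrow> real" where
  "endpoint_value k \<psi> = 1 / (sinh (real k * (2 * \<psi>)))\<^sup>2"

text \<open>
  This is \<open>1 / (2 \<bar>p'(0)\<bar>)\<close> for the scaled polynomial \<open>p\<close>, the limit of the objective as \<open>x\<close> tends to \<open>0\<close>.
\<close>

definition origin_value :: "nat \<Rightarrow> real \<Rightarrow> real" where
  "origin_value k \<psi> = tanh \<psi> / (2 * real k * tanh (real k * (2 * \<psi>)))"

text \<open>
  Identifies the tangent slope of \<open>cosh_ratio_ge_tangent\<close> at \<open>\<theta> = 2\<psi>\<close>, rescaled to the variable \<open>x\<close>,
  with the reciprocal of the value at the origin.
\<close>

lemma origin_value_inverse:
  assumes "\<psi> > 0" "k \<ge> 1"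
  shows "2 * (real k * tanh (real k * (2 * \<psi>)) / sinh (2 * \<psi>)) * (2 * x * (cosh \<psi>)\<^sup>2)
       = x / origin_value k \<psi>"
  using assms unfolding origin_value_def sinh_double
  by (simp add: tanh_def[of \<psi>] field_simps power2_eq_square)

text \<open>
  The point \<open>a = tanh\<^sup>2 \<psi>\<close> is mapped to \<open>1\<close> and \<open>x = 1\<close> to \<open>-1\<close>, so these bounds tell whether the
  trigonometric or the hyperbolic form of the Chebyshev polynomial applies.
\<close>

lemma chebyshev_arg_bounds:
  fixes \<psi> x :: real
  defines "y \<equiv> cosh (2 * \<psi>) - 2 * x * (cosh \<psi>)\<^sup>2"
  shows "x \<le> 1 \<Longrightarrow> -1 \<le> y" "(tanh \<psi>)\<^sup>2 \<le> x \<longleftrightarrow> y \<le> 1"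
proof -
  have c: "(cosh \<psi>)\<^sup>2 > 0" by simp
  show "-1 \<le> y" if "x \<le> 1"
    using mult_right_mono[OF that, of "(cosh \<psi>)\<^sup>2"] by (simp add: y_def cosh_double_cosh)
  have "(cosh \<psi>)\<^sup>2 * (tanh \<psi>)\<^sup>2 = (sinh \<psi>)\<^sup>2" by (simp add: tanh_def power_divide)
  then have "y = 1 + 2 * ((cosh \<psi>)\<^sup>2 * ((tanh \<psi>)\<^sup>2 - x))"
    unfolding y_def cosh_double right_diff_distrib by (simp add: cosh_square_eq)
  then have "y \<le> 1 \<longleftrightarrow> (cosh \<psi>)\<^sup>2 * ((tanh \<psi>)\<^sup>2 - x) \<le> 0" by simp
  then show "(tanh \<psi>)\<^sup>2 \<le> x \<longleftrightarrow> y \<le> 1"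
    using c by (auto simp: mult_le_0_iff)
qed

section \<open>The objective to the right of a\<close>

lemma cheb_scaled_sq_right_le:
  fixes k :: nat and \<psi> x :: real
  assumes "\<psi> > 0" "k \<ge> 1" "(tanh \<psi>)\<^sup>2 \<le> x" "x \<le> 1"
  shows "(cheb_scaled k ((tanh \<psi>)\<^sup>2) x)\<^sup>2 \<le> 1 / (cosh (real k * (2 * \<psi>)))\<^sup>2"
proof -
  define y where "y = cosh (2 * \<psi>) - 2 * x * (cosh \<psi>)\<^sup>2"
  have y: "-1 \<le> y" "y \<le> 1" using chebyshev_arg_bounds(1)[of x \<psi>] chebyshev_arg_bounds(2)[of \<psi> x] assms by (auto simp: y_def)
  then have "cheb k y = cos (real k * arccos y)"
    using cheb_cos[of k "arccos y"] by simp
  then have "(cheb k y)\<^sup>2 \<le> 1" by (simp add: abs_square_le_1)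
  then show ?thesis
    by (simp add: cheb_scaled_tanh y_def[symmetric] power_divide divide_right_mono)
qed

lemma one_less_cosh: "x \<noteq> 0 \<Longrightarrow> 1 < cosh (x::real)"
  using cosh_real_ge_1[of x] cosh_real_one_iff[of x] by linarith

text \<open>
  Both factors of \<open>x * (q / (1 - q))\<close> are bounded separately: \<open>x\<close> by \<open>1\<close>, and the increasing function
  \<open>q / (1 - q)\<close> by its value at \<open>1/D\<^sup>2\<close>. Since both bounds are attained at \<open>x = 1\<close>, nothing is lost.
\<close>

lemma objective_le_endpoint_value:
  assumes "\<psi> > 0" "k \<ge> 1" "(tanh \<psi>)\<^sup>2 \<le> x" "0 < x" "x \<le> 1"
  shows "objective k ((tanh \<psi>)\<^sup>2) x \<le> ereal (endpoint_value k \<psi>)"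
proof -
  define q where "q = (cheb_scaled k ((tanh \<psi>)\<^sup>2) x)\<^sup>2"
  define D where "D = (cosh (real k * (2 * \<psi>)))\<^sup>2"
  have D: "1 < D" using assms by (simp add: D_def one_less_cosh one_less_power)
  have q: "0 \<le> q" "q \<le> 1 / D" using cheb_scaled_sq_right_le assms by (auto simp: q_def D_def)
  have "1 / D < 1" using D by simp
  then have "q < 1" using q by linarith
  have "x * (q / (1 - q)) \<le> 1 * ((1 / D) / (1 - 1 / D))"
    using assms q D \<open>1 / D < 1\<close> \<open>q < 1\<close> by (intro mult_mono frac_le) auto
  also have "\<dots> = endpoint_value k \<psi>"
    using D by (simp add: endpoint_value_def D_def sinh_square_eq diff_divide_eq_iff)
  finally show ?thesis using objective_eq[of k "(tanh \<psi>)\<^sup>2" x] \<open>q < 1\<close> by (simp add: q_def)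
qed

lemma objective_at_1:
  assumes "\<psi> > 0" "k \<ge> 1"
  shows "objective k ((tanh \<psi>)\<^sup>2) 1 = ereal (endpoint_value k \<psi>)"
proof -
  define D where "D = (cosh (real k * (2 * \<psi>)))\<^sup>2"
  have D: "1 < D" using assms by (simp add: D_def one_less_cosh one_less_power)
  have "cosh (2 * \<psi>) - 2 * 1 * (cosh \<psi>)\<^sup>2 = cos pi" by (simp add: cosh_double_cosh)
  then have "(cheb k (cosh (2 * \<psi>) - 2 * 1 * (cosh \<psi>)\<^sup>2))\<^sup>2 = 1"
    by (simp only: cheb_cos) (simp add: power_mult[symmetric] mult.commute[of k])
  then have q: "(cheb_scaled k ((tanh \<psi>)\<^sup>2) 1)\<^sup>2 = 1 / D"
    by (simp only: cheb_scaled_tanh power_divide D_def)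
  have "objective k ((tanh \<psi>)\<^sup>2) 1 = ereal (1 * ((1 / D) / (1 - 1 / D)))"
    using objective_eq[of k "(tanh \<psi>)\<^sup>2" 1] D by (simp add: q)
  also have "1 * ((1 / D) / (1 - 1 / D)) = endpoint_value k \<psi>"
    using D by (simp add: endpoint_value_def D_def sinh_square_eq diff_divide_eq_iff)
  finally show ?thesis .
qed

section \<open>The objective to the left of a\<close>

lemma inverse_cheb_scaled_sq_ge_tangent:
  assumes "\<psi> > 0" "k \<ge> 1" "0 < x" "x < (tanh \<psi>)\<^sup>2"
  shows "(cheb_scaled k ((tanh \<psi>)\<^sup>2) x)\<^sup>2 > 0"
    and "1 + x / origin_value k \<psi> \<le> 1 / (cheb_scaled k ((tanh \<psi>)\<^sup>2) x)\<^sup>2"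
proof -
  define y where "y = cosh (2 * \<psi>) - 2 * x * (cosh \<psi>)\<^sup>2"
  define \<phi> where "\<phi> = arcosh y"
  have y: "1 < y" using chebyshev_arg_bounds(2)[of \<psi> x] assms by (auto simp: y_def)
  have \<phi>: "cosh \<phi> = y" "0 < \<phi>" using y by (auto simp: \<phi>_def)
  have "cosh \<phi> \<le> cosh (2 * \<psi>)" using assms \<phi> by (simp add: y_def)
  then have "\<phi> \<le> 2 * \<psi>" using assms \<phi>(2) by (subst (asm) cosh_real_nonneg_le_iff) auto
  have q: "cheb_scaled k ((tanh \<psi>)\<^sup>2) x = cosh (real k * \<phi>) / cosh (real k * (2 * \<psi>))"
    by (simp only: cheb_scaled_tanh y_def[symmetric] \<phi>(1)[symmetric] cheb_cosh)
  then show "(cheb_scaled k ((tanh \<psi>)\<^sup>2) x)\<^sup>2 > 0" by (simp add: power_divide)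
  have gap: "cosh (2 * \<psi>) - cosh \<phi> = 2 * x * (cosh \<psi>)\<^sup>2" using \<phi> by (simp add: y_def)
  have "1 + x / origin_value k \<psi> \<le> (cosh (real k * (2 * \<psi>)) / cosh (real k * \<phi>))\<^sup>2"
    using cosh_ratio_ge_tangent[OF \<phi>(2) \<open>\<phi> \<le> 2 * \<psi>\<close>, of k]
    unfolding gap origin_value_inverse[OF assms(1,2)] .
  then show "1 + x / origin_value k \<psi> \<le> 1 / (cheb_scaled k ((tanh \<psi>)\<^sup>2) x)\<^sup>2"
    by (simp only: q power_divide) simp
qed

lemma origin_value_pos: "\<psi> > 0 \<Longrightarrow> k \<ge> 1 \<Longrightarrow> origin_value k \<psi> > 0"
  by (simp add: origin_value_def)

text \<open>
  The tangent bound for \<open>1/q\<close> says that \<open>(1 - q) / q\<close> is at least \<open>x\<close> divided by the origin value. The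
  first equation isolates the difference quotient \<open>(1 - q) / x\<close>, which has a limit at \<open>0\<close>.
\<close>

lemma objective_left:
  assumes "\<psi> > 0" "k \<ge> 1" "0 < x" "x < (tanh \<psi>)\<^sup>2"
  defines "q \<equiv> (cheb_scaled k ((tanh \<psi>)\<^sup>2) x)\<^sup>2"
  shows "objective k ((tanh \<psi>)\<^sup>2) x = ereal (q / ((1 - q) / x))"
    and "objective k ((tanh \<psi>)\<^sup>2) x \<le> ereal (origin_value k \<psi>)"
proof -
  define L where "L = origin_value k \<psi>"
  have L: "L > 0" using origin_value_pos assms by (simp add: L_def)
  have q: "0 < q" "1 + x / L \<le> 1 / q" using inverse_cheb_scaled_sq_ge_tangent assms by (auto simp: q_def L_def)
  have "0 < x / L" using L assms by simp
  then have "1 < 1 / q" using q by linarith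
  then have "q < 1" using q by simp
  then show *: "objective k ((tanh \<psi>)\<^sup>2) x = ereal (q / ((1 - q) / x))"
    using objective_eq[of k "(tanh \<psi>)\<^sup>2" x] by (simp add: q_def mult.commute)
  have "x / L \<le> (1 - q) / q" using q by (simp add: diff_divide_distrib)
  then have "q / ((1 - q) / x) \<le> L"
    using q \<open>q < 1\<close> L assms by (simp add: field_simps)
  then show "objective k ((tanh \<psi>)\<^sup>2) x \<le> ereal (origin_value k \<psi>)"
    by (simp add: * L_def)
qed

section \<open>The limit of the objective at the origin\<close>

lemma cheb_has_derivative:
  assumes "y > 1"
  shows "(cheb k has_real_derivative real k * sinh (real k * arcosh y) / sinh (arcosh y)) (at y)"
proof (rule has_field_derivative_transform_within_open)
  show "((\<lambda>y. cosh (real k * arcosh y)) has_real_derivative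
          real k * sinh (real k * arcosh y) / sinh (arcosh y)) (at y)"
    using assms by (auto intro!: derivative_eq_intros simp: sinh_arcosh_real)
  show "open {1::real<..}" "y \<in> {1<..}" using assms by auto
  show "cosh (real k * arcosh z) = cheb k z" if "z \<in> {1<..}" for z
    using that cheb_cosh[of k "arcosh z"] by simp
qed

lemma cheb_scaled_sq_deriv_0:
  assumes "\<psi> > 0" "k \<ge> 1"
  shows "((\<lambda>x. (cheb_scaled k ((tanh \<psi>)\<^sup>2) x)\<^sup>2) has_real_derivative - (1 / origin_value k \<psi>)) (at 0)"
proof -
  define C where "C = cosh (real k * (2 * \<psi>))"
  define y where "y = (\<lambda>x. cosh (2 * \<psi>) - 2 * x * (cosh \<psi>)\<^sup>2)"
  have "1 < cosh (2 * \<psi>)" using assms by (simp add: one_less_cosh)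
  from cheb_has_derivative[OF this, of k]
  have "(cheb k has_real_derivative real k * sinh (real k * (2 * \<psi>)) / sinh (2 * \<psi>)) (at (y 0))"
    using assms by (simp add: y_def arcosh_cosh_real)
  moreover have "(y has_real_derivative - (2 * (cosh \<psi>)\<^sup>2)) (at 0)"
    unfolding y_def by (auto intro!: derivative_eq_intros)
  ultimately have "((\<lambda>x. cheb k (y x)) has_real_derivative
     real k * sinh (real k * (2 * \<psi>)) / sinh (2 * \<psi>) * - (2 * (cosh \<psi>)\<^sup>2)) (at 0)"
    by (rule DERIV_chain2)
  then have "((\<lambda>x. (cheb k (y x) / C)\<^sup>2) has_real_derivative
     2 * (real k * sinh (real k * (2 * \<psi>)) / sinh (2 * \<psi>) * - (2 * (cosh \<psi>)\<^sup>2)) / C) (at 0)"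
    by (auto intro!: derivative_eq_intros simp: cheb_cosh C_def y_def power2_eq_square)
  moreover have "2 * (real k * sinh (real k * (2 * \<psi>)) / sinh (2 * \<psi>) * - (2 * (cosh \<psi>)\<^sup>2)) / C
      = - (2 * (real k * tanh (real k * (2 * \<psi>)) / sinh (2 * \<psi>)) * (2 * 1 * (cosh \<psi>)\<^sup>2))"
    by (simp add: tanh_def C_def)
  ultimately show ?thesis
    unfolding origin_value_inverse[OF assms] cheb_scaled_tanh C_def y_def by simp
qed

text \<open>
  Left of \<open>a\<close> the objective is \<open>q / ((1 - q) / x)\<close> with \<open>q = p\<^sup>2\<close>. Since \<open>q 0 = 1\<close>, the inner quotient is a
  difference quotient at \<open>0\<close>, so the limit is \<open>-1 / q'(0)\<close>.
\<close>

lemma objective_tendsto_origin_value: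
  assumes "\<psi> > 0" "k \<ge> 1"
  shows "((\<lambda>x. objective k ((tanh \<psi>)\<^sup>2) x) \<longlongrightarrow> ereal (origin_value k \<psi>)) (at_right 0)"
proof -
  define q where "q = (\<lambda>x. (cheb_scaled k ((tanh \<psi>)\<^sup>2) x)\<^sup>2)"
  define L where "L = origin_value k \<psi>"
  have L: "L > 0" using origin_value_pos assms by (simp add: L_def)
  have q0: "q 0 = 1" by (simp add: q_def cheb_scaled_tanh cheb_cosh)
  have d: "(q has_real_derivative - (1 / L)) (at 0)"
    using cheb_scaled_sq_deriv_0[OF assms] by (simp add: q_def L_def)
  then have "(\<lambda>h. (q h - 1) / h) \<midarrow>0\<rightarrow> - (1 / L)" by (simp add: DERIV_def q0)
  then have "(\<lambda>h. - ((q h - 1) / h)) \<midarrow>0\<rightarrow> 1 / L" using tendsto_minus by fastforce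
  then have slope: "(\<lambda>h. (1 - q h) / h) \<midarrow>0\<rightarrow> 1 / L" by (simp add: minus_divide_left)
  have "q \<midarrow>0\<rightarrow> 1" using DERIV_isCont[OF d] q0 by (simp add: isCont_def)
  from tendsto_divide[OF this slope]
  have "(\<lambda>h. q h / ((1 - q h) / h)) \<midarrow>0\<rightarrow> 1 / (1 / L)" using L by simp
  then have "((\<lambda>h. ereal (q h / ((1 - q h) / h))) \<longlongrightarrow> ereal L) (at_right 0)"
    by (intro tendsto_ereal) (simp add: filterlim_at_split)
  moreover have "eventually (\<lambda>x. ereal (q x / ((1 - q x) / x)) = objective k ((tanh \<psi>)\<^sup>2) x) (at_right 0)"
    using eventually_at_right_real[of 0 "(tanh \<psi>)\<^sup>2"] assms
    by (auto elim!: eventually_mono simp: objective_left(1) q_def)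
  ultimately show ?thesis unfolding L_def using Lim_transform_eventually by fast
qed

section \<open>The supremum and its minimiser\<close>

lemma sup_objective_tanh:
  assumes "\<psi> > 0" "k \<ge> 1"
  shows "sup_objective k ((tanh \<psi>)\<^sup>2) = ereal (max (endpoint_value k \<psi>) (origin_value k \<psi>))"
proof (rule antisym)
  show "sup_objective k ((tanh \<psi>)\<^sup>2) \<le> ereal (max (endpoint_value k \<psi>) (origin_value k \<psi>))"
    unfolding sup_objective_def
  proof (rule SUP_least)
    fix x :: real assume x: "x \<in> {0<..1}"
    show "objective k ((tanh \<psi>)\<^sup>2) x \<le> ereal (max (endpoint_value k \<psi>) (origin_value k \<psi>))"
    proof (cases "(tanh \<psi>)\<^sup>2 \<le> x")
      case True
      then show ?thesis using objective_le_endpoint_value[OF assms True] x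
        by (auto intro: order_trans)
    next
      case False
      then show ?thesis using objective_left(2)[OF assms, of x] x
        by (auto intro: order_trans)
    qed
  qed
  have "ereal (endpoint_value k \<psi>) \<le> sup_objective k ((tanh \<psi>)\<^sup>2)"
    unfolding sup_objective_def objective_at_1[OF assms, symmetric] by (rule SUP_upper) simp
  moreover have "ereal (origin_value k \<psi>) \<le> sup_objective k ((tanh \<psi>)\<^sup>2)"
  proof (rule tendsto_upperbound[OF objective_tendsto_origin_value[OF assms]])
    show "\<forall>\<^sub>F x in at_right 0. objective k ((tanh \<psi>)\<^sup>2) x \<le> sup_objective k ((tanh \<psi>)\<^sup>2)"
      using eventually_at_right_real[of 0 1]
      by (auto elim!: eventually_mono simp: sup_objective_def intro!: SUP_upper)
  qed simp
  ultimately show "ereal (max (endpoint_value k \<psi>) (origin_value k \<psi>)) \<le> sup_objective k ((tanh \<psi>)\<^sup>2)"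
    by (simp add: max_def)
qed

text \<open>
  For \<open>a = 0\<close> the normalising constant is \<open>1\<close>, and the polynomial has absolute value \<open>1\<close> at \<open>x = 1\<close>.
\<close>

lemma sup_objective_0: "sup_objective k 0 = \<infinity>"
proof -
  have "cheb k 1 = 1" "(cheb k (-1))\<^sup>2 = 1"
    using cheb_cos[of k 0] cheb_cos[of k pi] by (simp_all add: power_mult[symmetric] mult.commute[of k])
  then have "objective k 0 1 = \<infinity>" by (simp add: objective_def cheb_scaled_def power_divide)
  then show ?thesis unfolding sup_objective_def
    by (metis SUP_upper ereal_infty_less_eq(1) greaterThanAtMost_iff order_refl zero_less_one)
qed

lemma endpoint_value_strict_antimono:
  assumes "0 < \<psi>" "\<psi> < \<psi>'" "k \<ge> 1"
  shows "endpoint_value k \<psi>' < endpoint_value k \<psi>"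
  unfolding endpoint_value_def using assms
  by (intro divide_strict_left_mono power_strict_mono mult_pos_pos zero_less_power) auto

lemma origin_value_strict_mono:
  assumes "0 < \<psi>" "\<psi> < \<psi>'" "k \<ge> 1"
  shows "origin_value k \<psi> < origin_value k \<psi>'"
proof -
  have eq: "origin_value k z = 1 / (2 * real k * (tanh (real (2 * k) * z) / tanh z))" for z
    by (simp add: origin_value_def mult_ac)
  show ?thesis unfolding eq
    using assms tanh_ratio_strict_antimono[OF assms(1,2), of "2 * k"]
    by (intro divide_strict_left_mono mult_strict_left_mono) auto
qed

text \<open>
  Replaces the agreement of the two values by the equation \<open>tanh \<psi> sinh (4k\<psi>) = 4k\<close>, in which the
  hyperbolic sine can be computed exactly when \<open>\<psi>\<close> is a multiple of \<open>ln k / k\<close>.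
\<close>

lemma endpoint_minus_origin:
  assumes "\<psi> > 0" "k \<ge> 1"
  shows "endpoint_value k \<psi> - origin_value k \<psi>
       = (4 * real k - tanh \<psi> * sinh (4 * real k * \<psi>)) / (4 * real k * (sinh (real k * (2 * \<psi>)))\<^sup>2)"
proof -
  define S C where "S = sinh (real k * (2 * \<psi>))" and "C = cosh (real k * (2 * \<psi>))"
  have "S > 0" using assms by (simp add: S_def)
  have d: "sinh (4 * real k * \<psi>) = 2 * S * C"
    using sinh_double[of "real k * (2 * \<psi>)"] by (simp add: S_def C_def mult_ac)
  have t: "tanh (real k * (2 * \<psi>)) = S / C" by (simp add: S_def C_def tanh_def)
  have "C > 0" by (simp add: C_def)
  show ?thesis
    unfolding endpoint_value_def origin_value_def t d unfolding S_def[symmetric]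
    using \<open>S > 0\<close> \<open>C > 0\<close> assms by (simp add: field_simps power2_eq_square)
qed

lemma ex_tanh_sq:
  fixes a :: real
  assumes "0 < a" "a < 1"
  obtains \<psi> :: real where "\<psi> > 0" "a = (tanh \<psi>)\<^sup>2"
proof
  define s where "s = sqrt a"
  have s: "0 < s" "s < 1" "a = s\<^sup>2" using assms by (auto simp: s_def)
  have t: "tanh (artanh s) = s"
  proof -
    have "tanh (artanh s) = tanh (ln (sqrt ((1 + s) / (1 - s))))"
      using s by (simp add: artanh_def ln_sqrt)
    also have "\<dots> = s" using s by (simp add: tanh_ln_real field_simps)
    finally show ?thesis .
  qed
  then show "artanh s > 0" using s tanh_real_pos_iff[of "artanh s"] by simp
  show "a = (tanh (artanh s))\<^sup>2" using t s by simp
qed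

text \<open>
  Left of the balance point the value at \<open>x = 1\<close> exceeds the common value, and right of it the value at
  the origin does. Hence every other \<open>a\<close> gives a strictly larger supremum.
\<close>

lemma minimizer_characterization:
  assumes "\<psi> > 0" "k \<ge> 1" "tanh \<psi> * sinh (4 * real k * \<psi>) = 4 * real k"
  shows "Lambda k = ereal (origin_value k \<psi>)"
    and "\<And>a. a \<in> {0<..<1} \<Longrightarrow> sup_objective k a = Lambda k \<longleftrightarrow> a = (tanh \<psi>)\<^sup>2"
proof -
  have eq: "endpoint_value k \<psi> = origin_value k \<psi>"
    using endpoint_minus_origin[OF assms(1,2)] assms(3) by simp
  have val: "sup_objective k ((tanh \<psi>)\<^sup>2) = ereal (origin_value k \<psi>)"
    using sup_objective_tanh[OF assms(1,2)] eq by simp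
  have less: "sup_objective k ((tanh \<psi>)\<^sup>2) < sup_objective k a"
    if a: "a \<in> {0..<1}" "a \<noteq> (tanh \<psi>)\<^sup>2" for a
  proof (cases "a = 0")
    case True
    then show ?thesis by (simp add: sup_objective_0 val)
  next
    case False
    then obtain \<phi> where \<phi>: "\<phi> > 0" "a = (tanh \<phi>)\<^sup>2" using a ex_tanh_sq[of a] by auto
    then have "\<phi> < \<psi> \<or> \<psi> < \<phi>" using a by auto
    then have "origin_value k \<psi> < max (endpoint_value k \<phi>) (origin_value k \<phi>)"
      using endpoint_value_strict_antimono[of \<phi> \<psi> k] origin_value_strict_mono[of \<psi> \<phi> k] eq assms \<phi>
      by auto
    then show ?thesis unfolding val \<phi>(2) sup_objective_tanh[OF \<phi>(1) assms(2)]
      by (rule less_ereal.simps(1)[THEN iffD2])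
  qed
  have in01: "(tanh \<psi>)\<^sup>2 \<in> {0..<1}"
    using assms tanh_real_lt_1[of \<psi>] by (simp add: abs_square_less_1)
  have L: "Lambda k = sup_objective k ((tanh \<psi>)\<^sup>2)"
    unfolding Lambda_def
    by (rule antisym[OF INF_lower[OF in01] INF_greatest]) (use less in fastforce)
  then show "Lambda k = ereal (origin_value k \<psi>)" by (simp add: val)
  show "sup_objective k a = Lambda k \<longleftrightarrow> a = (tanh \<psi>)\<^sup>2" if "a \<in> {0<..<1}" for a
    using less[of a] that L by (cases "a = (tanh \<psi>)\<^sup>2") auto
qed

section \<open>Location of the balance point\<close>

lemma tanh_le_self: "0 \<le> x \<Longrightarrow> tanh x \<le> (x::real)"
proof -
  assume x: "0 \<le> x"
  have "(\<lambda>t. t - tanh t) 0 \<le> (\<lambda>t::real. t - tanh t) x"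
  proof (rule DERIV_nonneg_imp_nondecreasing[OF x])
    fix t :: real
    have "((\<lambda>t. t - tanh t) has_real_derivative (tanh t)\<^sup>2) (at t)"
      by (auto intro!: derivative_eq_intros)
    then show "\<exists>d. ((\<lambda>t. t - tanh t) has_real_derivative d) (at t) \<and> 0 \<le> d"
      by (intro exI conjI) auto
  qed
  then show ?thesis by simp
qed

text \<open>
  The derivative of \<open>tanh\<close> is \<open>1 - tanh\<^sup>2\<close>, which is at least \<open>1 - t\<^sup>2\<close> by \<open>tanh_le_self\<close>.
\<close>

lemma tanh_ge_cubic: "0 \<le> x \<Longrightarrow> x - x ^ 3 / 3 \<le> tanh (x::real)"
proof -
  assume x: "0 \<le> x"
  have "(\<lambda>t. tanh t - (t - t ^ 3 / 3)) 0 \<le> (\<lambda>t::real. tanh t - (t - t ^ 3 / 3)) x"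
  proof (rule DERIV_nonneg_imp_nondecreasing[OF x])
    fix t :: real assume "0 \<le> t"
    have "((\<lambda>t. tanh t - (t - t ^ 3 / 3)) has_real_derivative (t\<^sup>2 - (tanh t)\<^sup>2)) (at t)"
      by (auto intro!: derivative_eq_intros)
    moreover have "(tanh t)\<^sup>2 \<le> t\<^sup>2" using tanh_le_self \<open>0 \<le> t\<close> by (intro power_mono) auto
    ultimately show "\<exists>d. ((\<lambda>t. tanh t - (t - t ^ 3 / 3)) has_real_derivative d) (at t) \<and> 0 \<le> d"
      by (intro exI conjI) auto
  qed
  then show ?thesis by simp
qed

lemma tanh_ge_linear:
  fixes x :: real
  assumes "0 \<le> x" "x \<le> 1 / 2"
  shows "11 / 12 * x \<le> tanh x"
proof -
  have "x * x\<^sup>2 \<le> x * (1 / 2)\<^sup>2" using assms by (intro mult_left_mono power_mono) auto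
  then have "x ^ 3 \<le> x / 4" by (simp add: power2_eq_square power3_eq_cube)
  then show ?thesis using tanh_ge_cubic[OF assms(1)] by linarith
qed

text \<open>
  The first two bounds keep \<open>ln k / k\<close> between \<open>1/k\<close> and \<open>1/2\<close>, the range in which \<open>tanh\<close> is nearly
  linear. The third makes the left side of the balance equation at most of order \<open>k\<close> at
  \<open>\<psi> = 3 ln k / (8k)\<close>.
\<close>

lemma ln_bounds:
  fixes k :: nat
  assumes "k \<ge> 3"
  shows "1 \<le> ln (real k)" "ln (real k) \<le> real k / 2" "ln (real k) \<le> 2 * sqrt (real k)"
proof -
  show "1 \<le> ln (real k)" using assms exp_le by (subst ln_ge_iff) auto
  have "ln (real k) = ln 2 + ln (real k / 2)" using assms by (simp add: ln_div)
  also have "\<dots> \<le> 1 + (real k / 2 - 1)"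
    using assms ln_le_minus_one[of 2] ln_le_minus_one[of "real k / 2"] by (intro add_mono) auto
  finally show "ln (real k) \<le> real k / 2" by simp
  have "ln (real k) = 2 * ln (sqrt (real k))" using assms by (simp add: ln_sqrt)
  also have "\<dots> \<le> 2 * sqrt (real k)" using assms ln_le_minus_one[of "sqrt (real k)"] by simp
  finally show "ln (real k) \<le> 2 * sqrt (real k)" .
qed

text \<open>
  At \<open>\<psi> = ln k / k\<close> the argument \<open>4k\<psi>\<close> is \<open>ln (k^4)\<close>, so the hyperbolic sine is a rational function of
  \<open>k\<close> of order \<open>k^4 / 2\<close>.
\<close>

lemma balance_upper:
  fixes k :: nat
  assumes "k \<ge> 3"
  defines "\<psi> \<equiv> ln (real k) / real k"
  shows "4 * real k \<le> tanh \<psi> * sinh (4 * real k * \<psi>)"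
proof -
  note b = ln_bounds[OF assms(1)]
  have k: "real k \<ge> 3" using assms by simp
  have e: "4 * real k * \<psi> = ln (real k ^ 4)" using k by (simp add: \<psi>_def ln_realpow)
  have "real k ^ 4 \<ge> 9 * (real k)\<^sup>2"
    using mult_right_mono[of "3^2" "(real k)\<^sup>2" "(real k)\<^sup>2"] power_mono[OF k, of 2]
    by (simp add: power_add[symmetric])
  moreover have "inverse (real k ^ 4) \<le> 1" using k by (simp add: inverse_le_1_iff)
  moreover have "(real k)\<^sup>2 \<ge> 9" using power_mono[OF k, of 2] by simp
  \<comment> \<open>The constant \<open>48/11\<close> compensates the factor \<open>11/12\<close> of \<open>tanh_ge_linear\<close>: their product is \<open>4\<close>.
    There is room, since \<open>sinh (ln (k^4)) \<ge> (9 k\<^sup>2 - 1) / 2\<close> and \<open>k\<^sup>2 \<ge> 9\<close>.\<close>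
  ultimately have s: "sinh (4 * real k * \<psi>) \<ge> 48 / 11 * (real k)\<^sup>2"
    using k unfolding e by (simp add: sinh_ln_real)
  have "11 / 12 * \<psi> \<le> tanh \<psi>" using b k by (intro tanh_ge_linear) (auto simp: \<psi>_def field_simps)
  moreover have "1 / real k \<le> \<psi>" using b k by (simp add: \<psi>_def divide_right_mono)
  ultimately have t: "11 / 12 / real k \<le> tanh \<psi>" by simp
  have "4 * real k = (11 / 12 / real k) * (48 / 11 * (real k)\<^sup>2)"
    using k by (simp add: power2_eq_square)
  also have "\<dots> \<le> tanh \<psi> * sinh (4 * real k * \<psi>)"
    using t s k b by (intro mult_mono) (auto simp: \<psi>_def)
  finally show ?thesis .
qed

text \<open>
  The factor \<open>3/8\<close> serves two purposes. It is small enough that \<open>4k\<psi> = ln (k powr (3/2))\<close>, so that the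
  hyperbolic sine stays below \<open>k\<close> times \<open>sqrt k\<close>. And it exceeds \<open>1/3\<close> by a margin that absorbs
  the passage from \<open>\<psi>\<close> to \<open>tanh \<psi>\<close>, so that \<open>tanh \<psi> \<ge> ln k / (3k)\<close>.
\<close>

lemma balance_lower:
  fixes k :: nat
  assumes "k \<ge> 3"
  defines "\<psi> \<equiv> 3 / 8 * (ln (real k) / real k)"
  shows "tanh \<psi> * sinh (4 * real k * \<psi>) \<le> 4 * real k"
proof -
  note b = ln_bounds[OF assms(1)]
  have k: "real k \<ge> 3" using assms by simp
  have e: "4 * real k * \<psi> = ln (sqrt (real k) ^ 3)"
    using k by (simp add: \<psi>_def ln_realpow ln_sqrt)
  have s: "sinh (4 * real k * \<psi>) \<le> sqrt (real k) * real k"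
  proof -
    define A where "A = sqrt (real k) ^ 3"
    have "A > 0" using k by (simp add: A_def)
    then have "sinh (ln A) \<le> A"
      using order_trans[of "- inverse A" 0 A] by (simp add: sinh_ln_real)
    then show ?thesis unfolding e A_def[symmetric] using k by (simp add: A_def power3_eq_cube mult.commute)
  qed
  have "tanh \<psi> \<le> \<psi>" using b k by (intro tanh_le_self) (auto simp: \<psi>_def)
  also have "\<psi> \<le> 3 / 8 * (2 * sqrt (real k) / real k)"
    unfolding \<psi>_def using b k by (intro mult_left_mono divide_right_mono) auto
  finally have t: "tanh \<psi> \<le> 3 / 4 * sqrt (real k) / real k" by simp
  have "tanh \<psi> * sinh (4 * real k * \<psi>) \<le> (3 / 4 * sqrt (real k) / real k) * (sqrt (real k) * real k)"
    using t s k b by (intro mult_mono) (auto simp: \<psi>_def)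
  also have "\<dots> = 3 / 4 * real k" using k by (simp add: field_simps)
  finally show ?thesis using k by linarith
qed

lemma balance_point_exists:
  fixes k :: nat
  assumes "k \<ge> 3"
  obtains \<psi> where "3 / 8 * (ln (real k) / real k) \<le> \<psi>" "\<psi> \<le> ln (real k) / real k"
    "tanh \<psi> * sinh (4 * real k * \<psi>) = 4 * real k"
proof -
  define g where "g = (\<lambda>\<psi>. tanh \<psi> * sinh (4 * real k * \<psi>))"
  have "g (3 / 8 * (ln (real k) / real k)) \<le> 4 * real k" "4 * real k \<le> g (ln (real k) / real k)"
    unfolding g_def using balance_lower[OF assms] balance_upper[OF assms] .
  moreover have "3 / 8 * (ln (real k) / real k) \<le> ln (real k) / real k"
    using ln_bounds(1)[OF assms] divide_nonneg_nonneg[of "ln (real k)" "real k"] by linarith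
  moreover have "continuous_on {3 / 8 * (ln (real k) / real k)..ln (real k) / real k} g"
    unfolding g_def by (intro continuous_intros) auto
  ultimately obtain \<psi> where "3 / 8 * (ln (real k) / real k) \<le> \<psi>" "\<psi> \<le> ln (real k) / real k" "g \<psi> = 4 * real k"
    using IVT' by blast
  with that show ?thesis unfolding g_def by blast
qed

theorem theorem2:
  fixes k :: nat
  assumes "k \<ge> 3"
  shows "(\<exists>a\<in>{0<..<1}. sup_objective k a = Lambda k) \<and>
         (\<forall>a\<in>{0<..<1}. sup_objective k a = Lambda k \<longrightarrow>
            (ln (real k))\<^sup>2 / (9 * (real k)\<^sup>2) \<le> a \<and>
            a \<le> (ln (real k))\<^sup>2 / (real k)\<^sup>2) \<and>
         ereal (ln (real k) / (6 * (real k)\<^sup>2)) \<le> Lambda k \<and>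
         Lambda k \<le> ereal (1.03 * (ln (real k) / (2 * (real k)\<^sup>2)))"
proof -
  define u where "u = ln (real k) / real k"
  have k: "real k \<ge> 3" using assms by simp
  have u: "0 < u" "u \<le> 1 / 2"
    using ln_bounds[OF assms] k by (auto simp: u_def field_simps)
  obtain \<psi> where \<psi>: "3 / 8 * u \<le> \<psi>" "\<psi> \<le> u" "tanh \<psi> * sinh (4 * real k * \<psi>) = 4 * real k"
    using balance_point_exists[OF assms] unfolding u_def by metis
  have pos: "\<psi> > 0" and k1: "k \<ge> 1" using u \<psi> assms by auto
  note min = minimizer_characterization[OF pos k1 \<psi>(3)]
  \<comment> \<open>\<open>11/12 * 3/8 = 11/32\<close> is just above \<open>1/3\<close>.\<close>
  have "u / 3 \<le> 11 / 12 * (3 / 8 * u)" using u by simp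
  also have "\<dots> \<le> tanh (3 / 8 * u)" using u by (intro tanh_ge_linear) auto
  also have "\<dots> \<le> tanh \<psi>" using \<psi> by simp
  finally have lo: "u / 3 \<le> tanh \<psi>" .
  have hi: "tanh \<psi> \<le> u" using tanh_le_self[of \<psi>] pos \<psi> by simp
  have "(u / 3)\<^sup>2 \<le> (tanh \<psi>)\<^sup>2" "(tanh \<psi>)\<^sup>2 \<le> u\<^sup>2"
    using lo hi u pos by (auto intro!: power_mono)
  then have A: "(ln (real k))\<^sup>2 / (9 * (real k)\<^sup>2) \<le> (tanh \<psi>)\<^sup>2" "(tanh \<psi>)\<^sup>2 \<le> (ln (real k))\<^sup>2 / (real k)\<^sup>2"
    by (auto simp: u_def power_divide power_mult_distrib)
  have in01: "(tanh \<psi>)\<^sup>2 \<in> {0<..<1}"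
    using pos tanh_real_lt_1[of \<psi>] by (simp add: abs_square_less_1)
  have "ln (real k) / (6 * (real k)\<^sup>2) = u / 3 / (2 * real k * 1)"
    by (simp add: u_def power2_eq_square)
  also have "\<dots> \<le> origin_value k \<psi>"
    unfolding origin_value_def using lo pos k u less_imp_le[OF tanh_real_lt_1]
    by (intro frac_le mult_left_mono) auto
  finally have B: "ln (real k) / (6 * (real k)\<^sup>2) \<le> origin_value k \<psi>" .
  \<comment> \<open>\<open>tanh (2 ln k) = (k^4 - 1) / (k^4 + 1)\<close> is at least \<open>80/82\<close>; the constant \<open>1.03\<close> of the upper bound
    comes from here.\<close>
  have T: "tanh (real k * (2 * u)) \<ge> 100 / 103"
  proof -
    have "real k * (2 * u) = ln ((real k)\<^sup>2)" using k by (simp add: u_def ln_realpow)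
    moreover have "(real k)\<^sup>2 \<ge> 9" using power_mono[OF k, of 2] by simp
    then have "((real k)\<^sup>2)\<^sup>2 \<ge> 9\<^sup>2" by (intro power_mono) auto
    ultimately show ?thesis using k by (simp add: tanh_ln_real field_simps)
  qed
  have "origin_value k \<psi> \<le> origin_value k u"
    using origin_value_strict_mono[OF pos _ k1, of u] \<psi>(2) by (cases "\<psi> = u") auto
  also have "\<dots> \<le> u / (2 * real k * (100 / 103))"
    unfolding origin_value_def using T u k tanh_le_self[of u]
    by (intro frac_le mult_left_mono) auto
  also have "\<dots> = 1.03 * (ln (real k) / (2 * (real k)\<^sup>2))"
    by (simp add: u_def power2_eq_square)
  finally have C: "origin_value k \<psi> \<le> 1.03 * (ln (real k) / (2 * (real k)\<^sup>2))" .
  show ?thesis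
  proof (intro conjI ballI impI bexI[OF _ in01])
    show "sup_objective k ((tanh \<psi>)\<^sup>2) = Lambda k" using min(2)[OF in01] by simp
  qed (use min A B C in auto)
qed

end
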